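(* Let $W$ be a non-negative, integer-valued random variable with $\mathbb{E}[W]=\lambda>0$, let $Z_\lambda\sim\mathrm{Po}(\lambda)$, let $s\geq 1$ be an integer, and suppose that $$\mathbb{E}\binom{W}{k}\leq\mathbb{E}\binom{Z_\lambda}{k},\qquad k=3,\ldots,s$$ (no condition if $s\le 2$). Let $W^\star$ be a random variable with the $W$-size-biased distribution. If $W^\star\leq_{s-cx}W+1$, then $W\leq_{(s+1)-cx}Z_\lambda$.
   Context: $\mathbb{Z}^+=\{0,1,2,\ldots\}$. $\mathrm{Po}(\lambda)$ is the Poisson distribution with mean $\lambda$. $\binom{a}{b}=0$ if $b>a$. Size biasing: for $W$ non-negative, integer-valued with mean $\lambda\in(0,\infty)$, $W^\star$ has mass function $\mathbb{P}(W^\star=j)=j\,\mathbb{P}(W=j)/\lambda$, $j\in\mathbb{Z}^+$. Forward difference: $\Delta f(j)=f(j+1)-f(j)$, $\Delta^i=\Delta\circ\Delta^{i-1}$. $s$-convex order ($s\ge1$ an integer): for non-negative integer-valued $X,Y$, $X\leq_{s-cx}Y$ means $\mathbb{E}f(X)\leq\mathbb{E}f(Y)$ for all $f\in\mathcal{F}_s$, where $\mathcal{F}_s=\{f:\mathbb{Z}^+\to\mathbb{R}\,:\,\Delta^if(j)\geq0\text{ for all }j\in\mathbb{Z}^+\text{ and }i=1,\ldots,s\}$ (such $f$ are nondecreasing, so the expectations are well defined in $(-\infty,+\infty]$). *)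

theory Defs
  imports "HOL-Probability.Probability"
begin

definition forward_difference :: "(nat \<Rightarrow> real) \<Rightarrow> nat \<Rightarrow> real" where
  "forward_difference f j = f (j + 1) - f j"

definition cx_functions :: "nat \<Rightarrow> (nat \<Rightarrow> real) set" where
  "cx_functions s = {f. \<forall>i\<in>{1..s}. \<forall>j. (forward_difference ^^ i) f j \<ge> 0}"

(* E[X] = E[X^+] - E[X^-] with values in the extended reals.  The Bochner integral is not used
   because it is 0 for non-integrable functions.  The value is the usual quasi-integral whenever
   E[X^-] is finite, in particular for X = f(W) with f nondecreasing on the natural numbers. *)
definition ext_expectation :: "'a measure \<Rightarrow> ('a \<Rightarrow> real) \<Rightarrow> ereal" where
  "ext_expectation M X =
     enn2ereal (\<integral>\<^sup>+ x. ennreal (max 0 (X x)) \<partial>M) - enn2ereal (\<integral>\<^sup>+ x. ennreal (max 0 (- X x)) \<partial>M)"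

(* X and Y may live on different probability spaces: only their laws matter. *)
definition s_convex_le ::
    "nat \<Rightarrow> 'a measure \<Rightarrow> ('a \<Rightarrow> nat) \<Rightarrow> 'b measure \<Rightarrow> ('b \<Rightarrow> nat) \<Rightarrow> bool" where
  "s_convex_le s M X N Y \<longleftrightarrow>
     (\<forall>f\<in>cx_functions s. ext_expectation M (\<lambda>x. f (X x)) \<le> ext_expectation N (\<lambda>y. f (Y y)))"

(* V, on N, has the size-biased distribution of W, on M; W is meant to have finite positive mean. *)
definition has_size_biased_distribution ::
    "'a measure \<Rightarrow> ('a \<Rightarrow> nat) \<Rightarrow> 'b measure \<Rightarrow> ('b \<Rightarrow> nat) \<Rightarrow> bool" where
  "has_size_biased_distribution M W N V \<longleftrightarrow>
     (\<forall>j. measure N {y \<in> space N. V y = j} =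
          real j * measure M {x \<in> space M. W x = j} / (\<integral>x. real (W x) \<partial>M))"

end

theory Submission
  imports Defs
begin

text \<open>
  Write \<open>u t r j\<close> for the binomial coefficient of \<open>j - t\<close> over \<open>r\<close>, set to zero when \<open>j < t\<close>.
  Newton's expansion with remainder (\<open>newton_expansion\<close>) writes every test function of order
  \<open>s + 1\<close> as a constant plus a nonnegative combination of the binomial coefficients of orders
  \<open>1, \<dots>, s\<close> and of the functions \<open>u t s\<close>, \<open>t \<ge> 1\<close>. So it suffices to compare the moments of \<open>W\<close>
  and of the Poisson variable \<open>Z\<close> for these functions only. For the binomial coefficients this is
  the hypothesis when the order is at least \<open>3\<close>; at order \<open>1\<close> both moments are \<open>lam\<close>, and at order
  \<open>2\<close> the bound is the size-bias hypothesis for the identity function (\<open>second_moment_le\<close>).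

  What remains is \<open>B t \<le> C t\<close>, where \<open>B t\<close> and \<open>C t\<close> are the expectations of \<open>u t s (W)\<close> and
  \<open>u t s (Z)\<close>. The function \<open>u (t + 1) (s - 1)\<close> is an admissible test function of order \<open>s\<close>, so by
  the definition of size biasing \<open>E (W g(W)) \<le> lam E (g(W + 1))\<close> for \<open>g = u (t + 1) (s - 1)\<close>. The
  absorption and Pascal identities turn both sides into values of \<open>B\<close>: for \<open>t \<ge> 1\<close>,
  \<open>(t + s) B t - t B (t + 1) \<le> lam (B (t - 1) - B t)\<close>.
  For \<open>C\<close> there is equality, because \<open>E (Z g(Z)) = lam E (g(Z + 1))\<close> characterises the Poisson law.
  The difference \<open>D = C - B\<close> therefore satisfies
  \<open>lam (D (t - 1) - D t) \<le> s D t + t (D t - D (t + 1))\<close>,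
  which rules out a negative minimum at any \<open>t \<ge> 1\<close>: there the left-hand side would be nonnegative
  and the right-hand side negative. Since \<open>D\<close> tends to \<open>0\<close> and \<open>D 0 \<ge> 0\<close> is the binomial moment
  bound of order \<open>s\<close>, it follows that \<open>D\<close> is nonnegative (\<open>minimum_principle\<close>,
  \<open>truncated_moment_le\<close>).

  All moments in this argument are finite: the size-bias inequality for binomial coefficients bounds
  each moment of \<open>W\<close> by moments of lower order (\<open>integrable_binomial\<close>). Only the test
  functions in the conclusion may have infinite expectation, and these are handled by integrating the
  nonnegative terms of Newton's expansion one by one.
\<close>

section \<open>Truncated binomial coefficients and Newton's expansion\<close>

text \<open>
  The case distinction matters for \<open>r = 0\<close>: truncated subtraction alone would give \<open>1\<close> below \<open>t\<close>,
  whereas the step function at \<open>t\<close> is the test function needed for \<open>s = 1\<close>.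
\<close>

definition truncated_binomial :: "nat \<Rightarrow> nat \<Rightarrow> nat \<Rightarrow> real" where
  "truncated_binomial t r j = (if j < t then 0 else real ((j - t) choose r))"

lemma truncated_binomial_nonneg [simp]: "truncated_binomial t r j \<ge> 0"
  by (simp add: truncated_binomial_def)

lemma truncated_binomial_0: "truncated_binomial 0 r j = real (j choose r)"
  by (simp add: truncated_binomial_def)

lemma truncated_binomial_eq_0: "j < t \<Longrightarrow> truncated_binomial t r j = 0"
  by (simp add: truncated_binomial_def)

lemma truncated_binomial_Suc_Suc: "truncated_binomial (Suc t) r (Suc j) = truncated_binomial t r j"
  by (simp add: truncated_binomial_def)

lemma truncated_binomial_pascal:
  "truncated_binomial t (Suc r) (Suc j) = truncated_binomial t (Suc r) j + truncated_binomial t r j"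
  by (cases "Suc j = t") (auto simp: truncated_binomial_def Suc_diff_le)

lemma truncated_binomial_le: "truncated_binomial t r j \<le> real (j choose r)"
  by (auto simp: truncated_binomial_def intro!: binomial_right_mono)

text \<open>
  The size-bias weight \<open>j\<close> is split as \<open>(j - t - r - 1) + (t + r + 1)\<close>; the first part is absorbed
  into the binomial coefficient and raises its order, and Pascal's rule does the rest. Thus the
  weighted truncated binomials of order \<open>r\<close> involve only unweighted ones of order \<open>r + 1\<close>.
\<close>

lemma truncated_binomial_absorb:
  "real j * truncated_binomial (Suc t) r j =
     real (t + Suc r) * truncated_binomial t (Suc r) j - real t * truncated_binomial (Suc t) (Suc r) j"
proof (cases "j \<le> t")
  case True
  then show ?thesis by (cases "j = t") (auto simp: truncated_binomial_def)
next
  case False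
  then obtain m where m: "j = t + Suc m"
    by (metis add_Suc_right less_natE not_le)
  have "Suc r * (Suc m choose Suc r) = Suc m * (m choose r)"
    by (rule Suc_times_binomial)
  hence "real (Suc r * (Suc m choose Suc r)) = real (Suc m * (m choose r))"
    by (simp only:)
  thus ?thesis
    by (simp add: truncated_binomial_def m algebra_simps)
qed

lemma forward_difference_truncated_binomial:
  "forward_difference (truncated_binomial t (Suc r)) = truncated_binomial t r"
  by (rule ext) (simp add: forward_difference_def truncated_binomial_pascal)

lemma cx_functions_SucI:
  assumes "\<And>j. forward_difference f j \<ge> 0" and "forward_difference f \<in> cx_functions s"
  shows "f \<in> cx_functions (Suc s)"
  unfolding cx_functions_def
proof (intro CollectI ballI allI)
  fix i j assume i: "i \<in> {1..Suc s}"
  then obtain k where k: "i = Suc k" by (cases i) auto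
  show "0 \<le> (forward_difference ^^ i) f j"
  proof (cases "k = 0")
    case True
    then show ?thesis using assms(1) k by simp
  next
    case False
    then have "k \<in> {1..s}" using i k by auto
    then show ?thesis
      using assms(2) unfolding cx_functions_def k by (simp add: funpow_swap1 del: atLeastAtMost_iff)
  qed
qed

lemma const_in_cx_functions: "(\<lambda>j. c) \<in> cx_functions s"
proof (induction s arbitrary: c)
  case 0
  show ?case by (simp add: cx_functions_def)
next
  case (Suc s)
  have "forward_difference (\<lambda>j. c) = (\<lambda>j. 0)"
    by (simp add: forward_difference_def fun_eq_iff)
  then show ?case by (intro cx_functions_SucI[of "\<lambda>j. c"]) (simp_all add: Suc)
qed

text \<open>
  The order \<open>r + 1\<close> is optimal when \<open>t \<ge> 1\<close>: the difference of order \<open>r + 1\<close> is the indicator of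
  \<open>t - 1\<close>, whose own difference takes the value \<open>-1\<close>.
\<close>

lemma truncated_binomial_in_cx_functions: "truncated_binomial t r \<in> cx_functions (Suc r)"
proof (induction r)
  case 0
  show ?case
    by (rule cx_functions_SucI)
      (auto simp: forward_difference_def truncated_binomial_def cx_functions_def)
next
  case (Suc r)
  then show ?case
    by (intro cx_functions_SucI[of "truncated_binomial t (Suc r)"])
       (simp_all add: forward_difference_truncated_binomial)
qed

lemma binomial_in_cx_functions: "(\<lambda>j. real (j choose k)) \<in> cx_functions s"
proof (induction s arbitrary: k)
  case 0
  show ?case by (simp add: cx_functions_def)
next
  case (Suc s)
  show ?case
  proof (cases k)
    case 0
    then show ?thesis using const_in_cx_functions[of 1 "Suc s"] by simp
  next
    case (Suc r)
    have "forward_difference (\<lambda>j. real (j choose Suc r)) = (\<lambda>j. real (j choose r))"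
      by (simp add: forward_difference_def fun_eq_iff)
    then show ?thesis using Suc.IH[of r] unfolding Suc
      by (intro cx_functions_SucI[of "\<lambda>j. real (j choose Suc r)"]) simp_all
  qed
qed

text \<open>
  Induction on \<open>j\<close>, with \<open>f\<close> and \<open>s\<close> arbitrary: the increment of the left-hand side is
  \<open>forward_difference f j\<close>, and Pascal's rule shows that the increment of the right-hand side is the
  expansion of \<open>forward_difference f\<close> to order \<open>s - 1\<close>.
\<close>

lemma newton_expansion:
  "f j = (\<Sum>i\<le>s. (forward_difference ^^ i) f 0 * real (j choose i)) +
         (\<Sum>t<j. (forward_difference ^^ Suc s) f t * truncated_binomial (Suc t) s j)"
proof (induction j arbitrary: f s)
  case 0
  have "(\<Sum>i\<le>s. (forward_difference ^^ i) f 0 * real (0 choose i)) = (\<Sum>i\<in>{0}. (forward_difference ^^ i) f 0 * real (0 choose i))"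
    by (intro sum.mono_neutral_right) (auto simp: binomial_eq_0)
  then show ?case by simp
next
  case (Suc j)
  define a where "a i = (forward_difference ^^ i) f" for i
  have a0: "a 0 = f" by (simp add: a_def)
  have a_Suc: "a (Suc i) = (forward_difference ^^ i) (forward_difference f)" for i
    by (simp add: a_def funpow_swap1)
  have f_Suc: "f (Suc j) = f j + forward_difference f j"
    by (simp add: forward_difference_def)
  have IH: "f j = (\<Sum>i\<le>s. a i 0 * real (j choose i)) + (\<Sum>t<j. a (Suc s) t * truncated_binomial (Suc t) s j)"
    using Suc[of f s] unfolding a_def .
  show ?case
  proof (cases s)
    case 0
    have "(\<Sum>t<j. a (Suc 0) t * truncated_binomial (Suc t) 0 (Suc j)) = (\<Sum>t<j. a (Suc 0) t * truncated_binomial (Suc t) 0 j)"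
      by (intro sum.cong) (auto simp: truncated_binomial_def)
    then show ?thesis
      using IH f_Suc a_Suc[of 0] unfolding a_def[symmetric] 0
      by (simp add: truncated_binomial_Suc_Suc) (simp add: truncated_binomial_def)
  next
    case s: (Suc r)
    have IH': "forward_difference f j = (\<Sum>i\<le>r. a (Suc i) 0 * real (j choose i)) +
        (\<Sum>t<j. a (Suc s) t * truncated_binomial (Suc t) r j)"
      using Suc[of "forward_difference f" r] unfolding a_Suc[symmetric] s .
    have "(\<Sum>i\<le>s. a i 0 * real (Suc j choose i)) =
        (\<Sum>i\<le>s. a i 0 * real (j choose i)) + (\<Sum>i\<le>r. a (Suc i) 0 * real (j choose i))"
      unfolding s sum.atMost_Suc_shift
      by (simp add: algebra_simps sum.distrib)
    moreover have "(\<Sum>t<Suc j. a (Suc s) t * truncated_binomial (Suc t) s (Suc j)) =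
        (\<Sum>t<j. a (Suc s) t * truncated_binomial (Suc t) s j) +
        (\<Sum>t<j. a (Suc s) t * truncated_binomial (Suc t) r j)"
      unfolding s sum.lessThan_Suc truncated_binomial_pascal
      by (simp add: algebra_simps sum.distrib truncated_binomial_eq_0)
    ultimately show ?thesis
      using IH IH' f_Suc unfolding a_def[symmetric] by linarith
  qed
qed

section \<open>A discrete minimum principle\<close>

text \<open>
  The recurrence says \<open>lam (D t - D (t + 1)) \<le> c D (t + 1) + (t + 1) (D (t + 1) - D (t + 2))\<close>. At a
  global minimum \<open>t + 1\<close> both differences have the sign that forces \<open>D (t + 1) \<ge> 0\<close>.
\<close>

lemma minimum_principle:
  fixes D :: "nat \<Rightarrow> real"
  assumes lim: "D \<longlonglongrightarrow> 0" and D0: "D 0 \<ge> 0" and lam: "lam \<ge> 0" and c: "c > 0"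
    and rec: "\<And>t. lam * (D t - D (Suc t)) \<le> (real (Suc t) + c) * D (Suc t) - real (Suc t) * D (Suc (Suc t))"
  shows "D t \<ge> 0"
proof (rule ccontr)
  assume "\<not> D t \<ge> 0"
  then have neg: "D t < 0" by simp
  from order_tendstoD(1)[OF lim neg] obtain T where T: "\<And>n. n \<ge> T \<Longrightarrow> D t < D n"
    by (auto simp: eventually_sequentially)
  \<comment> \<open>Beyond \<open>T\<close> the sequence exceeds the negative value \<open>D t\<close>, so a minimum over a finite range is global.\<close>
  define m where "m = arg_min_on D {..T+t}"
  have fin: "finite {..T+t}" "{..T+t} \<noteq> {}" by auto
  have min: "D m \<le> D n" for n
  proof (cases "n \<le> T + t")
    case True
    then show ?thesis unfolding m_def by (intro arg_min_least[OF fin]) auto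
  next
    case False
    then have "D t < D n" by (intro T) auto
    moreover have "D m \<le> D t" unfolding m_def by (intro arg_min_least[OF fin]) auto
    ultimately show ?thesis by simp
  qed
  have mneg: "D m < 0" using min[of t] neg by simp
  then obtain k where k: "m = Suc k" using D0 by (cases m) auto
  have "0 \<le> lam * (D k - D m)" using lam min[of k] by simp
  also have "\<dots> \<le> c * D m + real m * (D m - D (Suc m))"
    using rec[of k] unfolding k by (simp add: algebra_simps)
  also have "c * D m < 0" using c mneg by (simp add: mult_pos_neg)
  also have "real m * (D m - D (Suc m)) \<le> 0" using min[of "Suc m"] by (simp add: mult_nonneg_nonpos)
  finally show False by simp
qed

section \<open>Extended expectations\<close>

lemma ext_expectation_nonneg:
  assumes "\<And>x. X x \<ge> 0"
  shows "ext_expectation M X = enn2ereal (\<integral>\<^sup>+ x. ennreal (X x) \<partial>M)"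
proof -
  have "max 0 (- X x) = 0" "max 0 (X x) = X x" for x using assms[of x] by auto
  then show ?thesis by (simp add: ext_expectation_def zero_ennreal.rep_eq)
qed

text \<open>
  Shifting by a lower bound replaces the difference of two integrals by a single nonnegative one, to
  which the termwise comparison of Newton expansions applies.
\<close>

lemma ext_expectation_bounded_below:
  assumes "prob_space M" and [measurable]: "X \<in> borel_measurable M" and ge: "\<And>x. X x \<ge> c"
  shows "ext_expectation M X = enn2ereal (\<integral>\<^sup>+ x. ennreal (X x - c) \<partial>M) + ereal c"
proof -
  interpret prob_space M by fact
  define P where "P = (\<integral>\<^sup>+ x. ennreal (max 0 (X x)) \<partial>M)"
  define Q where "Q = (\<integral>\<^sup>+ x. ennreal (max 0 (- X x)) \<partial>M)"
  define G where "G = (\<integral>\<^sup>+ x. ennreal (X x - c) \<partial>M)"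
  have "max 0 (- X x) \<le> max 0 (- c)" for x
    using ge[of x] by (auto simp: max_def)
  then have "Q \<le> (\<integral>\<^sup>+ x. ennreal (max 0 (- c)) \<partial>M)"
    unfolding Q_def by (intro nn_integral_mono ennreal_leI)
  then have "Q \<le> ennreal (max 0 (- c))" by (simp add: emeasure_space_1)
  then obtain q where q: "Q = ennreal q" "q \<ge> 0"
    by (cases Q) (auto simp: top_unique)
  have "P + ennreal (max 0 (-c)) = (\<integral>\<^sup>+ x. ennreal (max 0 (X x)) + ennreal (max 0 (-c)) \<partial>M)"
    unfolding P_def by (subst nn_integral_add) (auto simp: emeasure_space_1)
  also have "\<dots> = (\<integral>\<^sup>+ x. (ennreal (max 0 (- X x)) + ennreal (X x - c)) + ennreal (max 0 c) \<partial>M)"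
  proof (rule nn_integral_cong)
    fix x
    have "max 0 (X x) + max 0 (- c) = (max 0 (- X x) + (X x - c)) + max 0 c"
      by (simp add: max_def)
    then show "ennreal (max 0 (X x)) + ennreal (max 0 (- c)) =
        (ennreal (max 0 (- X x)) + ennreal (X x - c)) + ennreal (max 0 c)"
      using ge[of x] by (metis diff_ge_0_iff_ge ennreal_plus max.cobounded1 add_nonneg_nonneg)
  qed
  also have "\<dots> = (Q + G) + ennreal (max 0 c)"
    unfolding Q_def G_def by (subst nn_integral_add, simp, simp, subst nn_integral_add) (auto simp: emeasure_space_1)
  finally have eq: "P + ennreal (max 0 (-c)) = (Q + G) + ennreal (max 0 c)" .
  have "enn2ereal P - enn2ereal Q = enn2ereal G + ereal c"
  proof (cases G)
    case top
    then have "P + ennreal (max 0 (-c)) = \<top>" using eq by simp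
    then have "P = \<top>" by (simp add: ennreal_add_eq_top)
    then show ?thesis using top q by (simp add: enn2ereal_ennreal)
  next
    case (real g)
    then have "P + ennreal (max 0 (-c)) \<noteq> \<top>" using eq q by (simp add: ennreal_add_eq_top)
    then have "P \<noteq> \<top>" by (simp add: ennreal_add_eq_top)
    then obtain p where p: "P = ennreal p" "p \<ge> 0" by (cases P) auto
    have "ennreal (p + max 0 (-c)) = ennreal (q + g + max 0 c)"
      using eq p q real by (simp add: ennreal_plus)
    then have "p + max 0 (-c) = q + g + max 0 c"
      using p q real by (subst (asm) ennreal_inj) auto
    then show ?thesis using p q real by (auto simp: enn2ereal_ennreal max_def split: if_splits)
  qed
  then show ?thesis by (simp add: ext_expectation_def P_def Q_def G_def)
qed

lemma cx_functions_ge_0: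
  assumes "f \<in> cx_functions (Suc s)"
  shows "f j \<ge> f 0"
proof -
  have "forward_difference f j \<ge> 0" for j
    using assms unfolding cx_functions_def by (auto dest!: bspec[where x=1])
  then have "f j \<le> f (Suc j)" for j by (simp add: forward_difference_def)
  from lift_Suc_mono_le[of f 0 j, OF this] show ?thesis by simp
qed

lemma nn_integral_newton_expansion:
  assumes f: "f \<in> cx_functions (Suc s)" and [measurable]: "X \<in> measurable M (count_space UNIV)"
  shows "(\<integral>\<^sup>+ x. ennreal (f (X x) - f 0) \<partial>M) =
     (\<Sum>i\<in>{1..s}. ennreal ((forward_difference ^^ i) f 0) * (\<integral>\<^sup>+ x. ennreal (real (X x choose i)) \<partial>M)) +
     (\<Sum>t. ennreal ((forward_difference ^^ Suc s) f t) *
            (\<integral>\<^sup>+ x. ennreal (truncated_binomial (Suc t) s (X x)) \<partial>M))"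
proof -
  define a where "a i j = (forward_difference ^^ i) f j" for i j
  have a: "a i j \<ge> 0" if "i \<in> {1..Suc s}" for i j
    using f that unfolding a_def cx_functions_def by blast
  have eq: "ennreal (f j - f 0) = (\<Sum>i\<in>{1..s}. ennreal (a i 0) * ennreal (real (j choose i))) +
     (\<Sum>t. ennreal (a (Suc s) t) * ennreal (truncated_binomial (Suc t) s j))" for j
  proof -
    have "{..s} = insert 0 {1..s}" by auto
    then have "f j - f 0 = (\<Sum>i\<in>{1..s}. a i 0 * real (j choose i)) +
         (\<Sum>t<j. a (Suc s) t * truncated_binomial (Suc t) s j)"
      using newton_expansion[of f j s] unfolding a_def by simp
    moreover have "(\<Sum>t. ennreal (a (Suc s) t) * ennreal (truncated_binomial (Suc t) s j)) =
        (\<Sum>t<j. ennreal (a (Suc s) t) * ennreal (truncated_binomial (Suc t) s j))"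
      by (intro suminf_finite) (auto simp: truncated_binomial_eq_0)
    moreover have "(\<Sum>t<j. ennreal (a (Suc s) t) * ennreal (truncated_binomial (Suc t) s j)) =
        ennreal (\<Sum>t<j. a (Suc s) t * truncated_binomial (Suc t) s j)"
      using a by (simp add: ennreal_mult[symmetric])
    moreover have "(\<Sum>i\<in>{1..s}. ennreal (a i 0) * ennreal (real (j choose i))) =
        ennreal (\<Sum>i\<in>{1..s}. a i 0 * real (j choose i))"
      using a by (subst sum_ennreal[symmetric]) (auto simp: ennreal_mult intro!: sum.cong)
    moreover have "ennreal ((\<Sum>i\<in>{1..s}. a i 0 * real (j choose i)) +
          (\<Sum>t<j. a (Suc s) t * truncated_binomial (Suc t) s j)) =
        ennreal (\<Sum>i\<in>{1..s}. a i 0 * real (j choose i)) +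
        ennreal (\<Sum>t<j. a (Suc s) t * truncated_binomial (Suc t) s j)"
      using a by (intro ennreal_plus sum_nonneg mult_nonneg_nonneg) auto
    ultimately show ?thesis by simp
  qed
  show ?thesis
    unfolding eq a_def[symmetric]
    by (simp add: nn_integral_add nn_integral_sum nn_integral_suminf nn_integral_cmult)
qed

section \<open>The size-bias inequality\<close>

text \<open>
  This is the comparison of the size-biased law with the law of \<open>W + 1\<close>, freed from the size-biased
  variable itself and restricted to nonnegative test functions, so that both sides make sense in
  \<open>[0, \<infinity>]\<close> before any moment is known to be finite.
  In this form it also holds, with equality, for the Poisson law, and the finiteness of moments can be
  derived for both variables at once.
\<close>

definition size_bias_le :: "real \<Rightarrow> nat \<Rightarrow> 'a measure \<Rightarrow> ('a \<Rightarrow> nat) \<Rightarrow> bool" where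
  "size_bias_le lam s M W \<longleftrightarrow> (\<forall>g\<in>cx_functions s. (\<forall>j. g j \<ge> 0) \<longrightarrow>
     (\<integral>\<^sup>+ x. ennreal (real (W x) * g (W x)) \<partial>M) \<le> ennreal lam * (\<integral>\<^sup>+ x. ennreal (g (Suc (W x))) \<partial>M))"

lemma size_bias_leD:
  assumes "size_bias_le lam s M W" and "g \<in> cx_functions s" and "\<And>j. g j \<ge> 0"
  shows "(\<integral>\<^sup>+ x. ennreal (real (W x) * g (W x)) \<partial>M) \<le> ennreal lam * (\<integral>\<^sup>+ x. ennreal (g (Suc (W x))) \<partial>M)"
  using assms by (simp add: size_bias_le_def)

lemma nn_integral_size_biased:
  assumes "prob_space M" and [measurable]: "W \<in> measurable M (count_space UNIV)"
    and "prob_space L" and [measurable]: "V \<in> measurable L (count_space UNIV)"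
    and sb: "has_size_biased_distribution M W L V"
    and lam: "(\<integral>x. real (W x) \<partial>M) = lam" "lam > 0"
    and g: "\<And>j. g j \<ge> 0"
  shows "(\<integral>\<^sup>+ x. ennreal (real (W x) * g (W x)) \<partial>M) = ennreal lam * (\<integral>\<^sup>+ y. ennreal (g (V y)) \<partial>L)"
proof -
  interpret M: prob_space M by fact
  interpret L: prob_space L by fact
  have "distr L (count_space UNIV) V = density (distr M (count_space UNIV) W) (\<lambda>j. ennreal (real j / lam))"
  proof (rule measure_eqI_countable)
    fix j :: nat
    have V: "V -` {j} \<inter> space L = {y \<in> space L. V y = j}" and W: "W -` {j} \<inter> space M = {x \<in> space M. W x = j}"
      by auto
    have "emeasure (density (distr M (count_space UNIV) W) (\<lambda>j. ennreal (real j / lam))) {j} =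
       ennreal (real j / lam) * emeasure (distr M (count_space UNIV) W) {j}"
    proof -
      have "ennreal (real i / lam) * indicator {j} i = ennreal (real j / lam) * indicator {j} i" for i
        by (simp add: indicator_def)
      then show ?thesis by (simp add: emeasure_density nn_integral_cmult_indicator)
    qed
    then show "emeasure (distr L (count_space UNIV) V) {j} =
       emeasure (density (distr M (count_space UNIV) W) (\<lambda>j. ennreal (real j / lam))) {j}"
      using sb lam unfolding has_size_biased_distribution_def
      by (simp add: emeasure_distr V W M.emeasure_eq_measure L.emeasure_eq_measure ennreal_mult[symmetric])
  qed (auto)
  then have "(\<integral>\<^sup>+ y. ennreal (g (V y)) \<partial>L) =
      (\<integral>\<^sup>+ j. ennreal (g j) \<partial>density (distr M (count_space UNIV) W) (\<lambda>j. ennreal (real j / lam)))"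
    by (subst nn_integral_distr[symmetric, where M'="count_space UNIV" and T=V]) auto
  also have "\<dots> = (\<integral>\<^sup>+ x. ennreal (real (W x) / lam) * ennreal (g (W x)) \<partial>M)"
    by (simp add: nn_integral_density nn_integral_distr)
  finally have "ennreal lam * (\<integral>\<^sup>+ y. ennreal (g (V y)) \<partial>L) =
      (\<integral>\<^sup>+ x. ennreal lam * (ennreal (real (W x) / lam) * ennreal (g (W x))) \<partial>M)"
    by (simp add: nn_integral_cmult)
  also have "\<dots> = (\<integral>\<^sup>+ x. ennreal (real (W x) * g (W x)) \<partial>M)"
    using lam g by (intro nn_integral_cong) (simp add: ennreal_mult[symmetric])
  finally show ?thesis by simp
qed

text \<open>
  The characterising identity of the Poisson law: termwise, \<open>(j + 1) P(Z = j + 1) = lam P(Z = j)\<close>.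
\<close>

lemma nn_integral_poisson_mult:
  assumes [measurable]: "Z \<in> measurable N (count_space UNIV)"
    and Z: "distr N (count_space UNIV) Z = measure_pmf (poisson_pmf lam)"
    and lam: "lam > 0" and g: "\<And>j. g j \<ge> 0"
  shows "(\<integral>\<^sup>+ x. ennreal (real (Z x) * g (Z x)) \<partial>N) = ennreal lam * (\<integral>\<^sup>+ x. ennreal (g (Suc (Z x))) \<partial>N)"
proof -
  have law: "(\<integral>\<^sup>+ x. ennreal (h (Z x)) \<partial>N) = (\<Sum>j. ennreal (pmf (poisson_pmf lam) j) * ennreal (h j))" for h
    by (subst nn_integral_distr[symmetric, where M'="count_space UNIV" and T=Z])
       (auto simp: Z nn_integral_measure_pmf nn_integral_count_space_nat)
  have step: "ennreal (pmf (poisson_pmf lam) (Suc j)) * ennreal (real (Suc j) * g (Suc j)) =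
      ennreal lam * (ennreal (pmf (poisson_pmf lam) j) * ennreal (g (Suc j)))" for j
  proof -
    have "pmf (poisson_pmf lam) (Suc j) * (real (Suc j) * g (Suc j)) = lam * (pmf (poisson_pmf lam) j * g (Suc j))"
      using lam by (simp add: divide_simps)
    then show ?thesis using lam g by (simp add: ennreal_mult[symmetric])
  qed
  show ?thesis
    unfolding law[of "\<lambda>j. real j * g j"] law[of "\<lambda>j. g (Suc j)"] ennreal_suminf_cmult[symmetric] step[symmetric]
    \<comment> \<open>The term at \<open>0\<close> vanishes because of the factor \<open>j\<close>.\<close>
    by (subst suminf_offset[where i=1]) (auto intro!: summableI)
qed

lemma size_bias_le_poisson:
  assumes "Z \<in> measurable N (count_space UNIV)"
    and "distr N (count_space UNIV) Z = measure_pmf (poisson_pmf lam)" and "lam > 0"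
  shows "size_bias_le lam s N Z"
  unfolding size_bias_le_def
proof (intro ballI impI)
  fix g :: "nat \<Rightarrow> real"
  assume "\<forall>j. g j \<ge> 0"
  then show "(\<integral>\<^sup>+ x. ennreal (real (Z x) * g (Z x)) \<partial>N) \<le> ennreal lam * (\<integral>\<^sup>+ x. ennreal (g (Suc (Z x))) \<partial>N)"
    using nn_integral_poisson_mult[OF assms, of g] by simp
qed

text \<open>
  Induction on \<open>k\<close>: the binomial coefficient of order \<open>k + 1\<close> is at most \<open>W\<close> times that of order \<open>k\<close>,
  and the size-bias inequality removes the factor \<open>W\<close> at the price of replacing \<open>W\<close> by \<open>W + 1\<close>.
  Hence the moments of \<open>W + 1\<close> are carried along in the induction.
\<close>

lemma integrable_binomial:
  assumes "prob_space M" and [measurable]: "W \<in> measurable M (count_space UNIV)"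
    and sb: "size_bias_le lam s M W"
  shows "integrable M (\<lambda>x. real (W x choose k))"
proof -
  interpret prob_space M by fact
  have "(\<integral>\<^sup>+ x. ennreal (real (W x choose k)) \<partial>M) < \<infinity> \<and> (\<integral>\<^sup>+ x. ennreal (real (Suc (W x) choose k)) \<partial>M) < \<infinity>"
  proof (induction k)
    case 0
    show ?case by (simp add: emeasure_space_1)
  next
    case (Suc k)
    have "n choose Suc k \<le> n * (n choose k)" for n
    proof -
      have "Suc k * (n choose Suc k) = (n - k) * (n choose k)"
        using binomial_absorb_comp[of n k] binomial_absorption[of k n] by simp
      then have "n choose Suc k \<le> (n - k) * (n choose k)" by (metis mult_Suc le_add1)
      also have "\<dots> \<le> n * (n choose k)" by (intro mult_right_mono) auto
      finally show ?thesis .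
    qed
    then have le: "real (n choose Suc k) \<le> real n * real (n choose k)" for n
      by (metis of_nat_le_iff of_nat_mult)
    have "(\<integral>\<^sup>+ x. ennreal (real (W x choose Suc k)) \<partial>M) \<le> (\<integral>\<^sup>+ x. ennreal (real (W x) * real (W x choose k)) \<partial>M)"
      by (intro nn_integral_mono ennreal_leI le)
    also have "\<dots> \<le> ennreal lam * (\<integral>\<^sup>+ x. ennreal (real (Suc (W x) choose k)) \<partial>M)"
      by (rule size_bias_leD[OF sb binomial_in_cx_functions]) simp
    also have "\<dots> < \<infinity>"
      using Suc by (simp add: ennreal_mult_less_top)
    finally have 1: "(\<integral>\<^sup>+ x. ennreal (real (W x choose Suc k)) \<partial>M) < \<infinity>" .
    have "(\<integral>\<^sup>+ x. ennreal (real (Suc (W x) choose Suc k)) \<partial>M) =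
       (\<integral>\<^sup>+ x. ennreal (real (W x choose k)) \<partial>M) + (\<integral>\<^sup>+ x. ennreal (real (W x choose Suc k)) \<partial>M)"
      by (subst nn_integral_add[symmetric]) auto
    with 1 Suc show ?case by simp
  qed
  then show ?thesis by (intro integrableI_nonneg) auto
qed

lemma integrable_truncated_binomial:
  assumes "prob_space M" and [measurable]: "W \<in> measurable M (count_space UNIV)"
    and "size_bias_le lam s M W"
  shows "integrable M (\<lambda>x. truncated_binomial t r (W x))"
  by (rule Bochner_Integration.integrable_bound[OF integrable_binomial[OF assms, of r]])
     (auto simp: truncated_binomial_le)

lemma truncated_moment_tendsto_0:
  assumes "prob_space M" and [measurable]: "W \<in> measurable M (count_space UNIV)"
    and "size_bias_le lam s M W"
  shows "(\<lambda>t. \<integral>x. truncated_binomial t r (W x) \<partial>M) \<longlonglongrightarrow> 0"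
proof -
  have "(\<lambda>t. \<integral>x. truncated_binomial t r (W x) \<partial>M) \<longlonglongrightarrow> (\<integral>x. 0 \<partial>M)"
  proof (rule integral_dominated_convergence[where w="\<lambda>x. real (W x choose r)"])
    show "integrable M (\<lambda>x. real (W x choose r))"
      using integrable_binomial[OF assms] .
    have "(\<lambda>t. truncated_binomial t r j) \<longlonglongrightarrow> 0" for j
      by (rule tendsto_eventually, rule eventually_mono[OF eventually_gt_at_top[of j]])
         (simp add: truncated_binomial_eq_0)
    then show "AE x in M. (\<lambda>t. truncated_binomial t r (W x)) \<longlonglongrightarrow> 0" by simp
  qed (auto simp: truncated_binomial_le)
  then show ?thesis by simp
qed

lemma integral_le_of_nn_integral_le:
  assumes "integrable M X" "integrable N Y" "\<And>x. X x \<ge> 0" "\<And>y. Y y \<ge> 0"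
    and "(\<integral>\<^sup>+ x. ennreal (X x) \<partial>M) \<le> ennreal c * (\<integral>\<^sup>+ y. ennreal (Y y) \<partial>N)" "c \<ge> 0"
  shows "(\<integral>x. X x \<partial>M) \<le> c * (\<integral>y. Y y \<partial>N)"
  using assms by (simp add: nn_integral_eq_integral ennreal_mult[symmetric] integral_nonneg)

lemma integral_poisson_mult:
  assumes Z: "Z \<in> measurable N (count_space UNIV)"
      "distr N (count_space UNIV) Z = measure_pmf (poisson_pmf lam)" and lam: "lam > 0"
    and g: "\<And>j. g j \<ge> 0"
    and int: "integrable N (\<lambda>x. real (Z x) * g (Z x))" "integrable N (\<lambda>x. g (Suc (Z x)))"
  shows "(\<integral>x. real (Z x) * g (Z x) \<partial>N) = lam * (\<integral>x. g (Suc (Z x)) \<partial>N)"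
proof -
  have "(\<integral>\<^sup>+ x. ennreal (real (Z x) * g (Z x)) \<partial>N) = ennreal (\<integral>x. real (Z x) * g (Z x) \<partial>N)"
    using int(1) g by (intro nn_integral_eq_integral) auto
  moreover have "(\<integral>\<^sup>+ x. ennreal (g (Suc (Z x))) \<partial>N) = ennreal (\<integral>x. g (Suc (Z x)) \<partial>N)"
    using int(2) g by (intro nn_integral_eq_integral) auto
  moreover have "(\<integral>\<^sup>+ x. ennreal (real (Z x) * g (Z x)) \<partial>N) = ennreal lam * (\<integral>\<^sup>+ x. ennreal (g (Suc (Z x))) \<partial>N)"
    by (rule nn_integral_poisson_mult[OF Z lam g])
  ultimately have "ennreal (\<integral>x. real (Z x) * g (Z x) \<partial>N) = ennreal (lam * (\<integral>x. g (Suc (Z x)) \<partial>N))"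
    using g lam by (simp add: ennreal_mult integral_nonneg)
  then show ?thesis using g lam by (subst (asm) ennreal_inj) (auto simp: integral_nonneg)
qed

text \<open>
  The two sides of the size-bias inequality for the test function \<open>truncated_binomial (t + 2) r\<close>,
  expressed through the truncated moments \<open>B\<close> of order \<open>r + 1\<close>. The truncation point is at least \<open>2\<close>
  because the shift by one on the right-hand side lowers it, and Pascal's rule needs to lower it once
  more.
\<close>

lemma integral_truncated_binomial_step:
  fixes r t :: nat
  assumes "prob_space M" and [measurable]: "W \<in> measurable M (count_space UNIV)"
    and "size_bias_le lam s M W"
  defines "B \<equiv> \<lambda>t. \<integral>x. truncated_binomial t (Suc r) (W x) \<partial>M"
  shows "has_bochner_integral M (\<lambda>x. real (W x) * truncated_binomial (Suc (Suc t)) r (W x))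
           (real (Suc t + Suc r) * B (Suc t) - real (Suc t) * B (Suc (Suc t)))"
    and "has_bochner_integral M (\<lambda>x. truncated_binomial (Suc (Suc t)) r (Suc (W x))) (B t - B (Suc t))"
proof -
  note [simp, intro] = integrable_truncated_binomial[OF assms(1-3)]
  show "has_bochner_integral M (\<lambda>x. real (W x) * truncated_binomial (Suc (Suc t)) r (W x))
           (real (Suc t + Suc r) * B (Suc t) - real (Suc t) * B (Suc (Suc t)))"
    unfolding truncated_binomial_absorb B_def has_bochner_integral_iff by simp
  have "truncated_binomial (Suc (Suc t)) r (Suc j) =
      truncated_binomial t (Suc r) j - truncated_binomial (Suc t) (Suc r) j" for j
    using truncated_binomial_pascal[of "Suc t" r j] by (simp add: truncated_binomial_Suc_Suc)
  then show "has_bochner_integral M (\<lambda>x. truncated_binomial (Suc (Suc t)) r (Suc (W x))) (B t - B (Suc t))"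
    unfolding B_def has_bochner_integral_iff by simp
qed

section \<open>Comparison with the Poisson distribution\<close>

text \<open>
  The minimum principle applied to the difference of the truncated moments. The bound on the binomial
  moment of order \<open>r + 1\<close> is its boundary condition at \<open>t = 0\<close>, and the size-bias inequality, minus the
  corresponding equality for the Poisson variable, is its recurrence.
\<close>

lemma truncated_moment_le:
  assumes M: "prob_space M" "W \<in> measurable M (count_space UNIV)" "size_bias_le lam (Suc r) M W"
    and N: "prob_space N" "Z \<in> measurable N (count_space UNIV)"
      "distr N (count_space UNIV) Z = measure_pmf (poisson_pmf lam)" and lam: "lam > 0"
    and 0: "(\<integral>x. real (W x choose Suc r) \<partial>M) \<le> (\<integral>x. real (Z x choose Suc r) \<partial>N)"
  shows "(\<integral>x. truncated_binomial t (Suc r) (W x) \<partial>M) \<le> (\<integral>x. truncated_binomial t (Suc r) (Z x) \<partial>N)"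
proof -
  define B where "B = (\<lambda>t. \<integral>x. truncated_binomial t (Suc r) (W x) \<partial>M)"
  define C where "C = (\<lambda>t. \<integral>x. truncated_binomial t (Suc r) (Z x) \<partial>N)"
  note N' = N(1,2) size_bias_le_poisson[OF N(2,3) lam, of "Suc r"]
  have recB: "real (Suc t + Suc r) * B (Suc t) - real (Suc t) * B (Suc (Suc t)) \<le> lam * (B t - B (Suc t))" for t
  proof -
    note * = integral_truncated_binomial_step[OF M, where r=r and t=t, folded B_def]
    have "(\<integral>\<^sup>+ x. ennreal (real (W x) * truncated_binomial (Suc (Suc t)) r (W x)) \<partial>M) \<le>
        ennreal lam * (\<integral>\<^sup>+ x. ennreal (truncated_binomial (Suc (Suc t)) r (Suc (W x))) \<partial>M)"
      by (rule size_bias_leD[OF M(3) truncated_binomial_in_cx_functions]) simp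
    from integral_le_of_nn_integral_le[OF _ _ _ _ this] * lam show ?thesis
      by (simp add: has_bochner_integral_iff B_def)
  qed
  have recC: "real (Suc t + Suc r) * C (Suc t) - real (Suc t) * C (Suc (Suc t)) = lam * (C t - C (Suc t))" for t
  proof -
    note * = integral_truncated_binomial_step[OF N', where r=r and t=t, folded C_def]
    show ?thesis
      using integral_poisson_mult[OF N(2,3) lam, of "truncated_binomial (Suc (Suc t)) r"] *
      by (simp add: has_bochner_integral_iff C_def)
  qed
  have "0 \<le> C t - B t"
  proof (rule minimum_principle[where lam=lam and c="real (Suc r)"])
    show "(\<lambda>t. C t - B t) \<longlonglongrightarrow> 0"
      using tendsto_diff[OF truncated_moment_tendsto_0[OF N', of "Suc r"] truncated_moment_tendsto_0[OF M, of "Suc r"]]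
      by (simp add: B_def C_def)
    show "0 \<le> C 0 - B 0" using 0 by (simp add: B_def C_def truncated_binomial_0)
    show "lam * (C t - B t - (C (Suc t) - B (Suc t))) \<le>
        (real (Suc t) + real (Suc r)) * (C (Suc t) - B (Suc t)) - real (Suc t) * (C (Suc (Suc t)) - B (Suc (Suc t)))" for t
      using recB[of t] recC[of t] by (simp add: algebra_simps)
  qed (use lam in auto)
  then show ?thesis by (simp add: B_def C_def)
qed

lemma square_eq_binomial: "real n * real n = 2 * real (n choose 2) + real n"
  by (induction n) (auto simp: algebra_simps numeral_2_eq_2)

text \<open>
  The identity function lies in every class of test functions, and the size-bias inequality for it reads
  \<open>E (W\<^sup>2) \<le> lam (E W + 1)\<close>.
\<close>

lemma second_moment_le:
  assumes "prob_space M" and [measurable]: "W \<in> measurable M (count_space UNIV)"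
    and sb: "size_bias_le lam s M W"
    and mean: "(\<integral>x. real (W x) \<partial>M) = lam" and lam: "lam > 0"
  shows "2 * (\<integral>x. real (W x choose 2) \<partial>M) \<le> lam\<^sup>2"
proof -
  interpret prob_space M by fact
  note int = integrable_binomial[OF assms(1-3)]
  have int1: "integrable M (\<lambda>x. real (W x))" using int[of 1] by simp
  have "(\<integral>\<^sup>+ x. ennreal (real (W x) * real (W x)) \<partial>M) \<le> ennreal lam * (\<integral>\<^sup>+ x. ennreal (real (Suc (W x))) \<partial>M)"
    using size_bias_leD[OF sb binomial_in_cx_functions[of 1]] by simp
  from integral_le_of_nn_integral_le[OF _ _ _ _ this] int[of 2] int1 mean lam show ?thesis
    by (simp add: square_eq_binomial algebra_simps power2_eq_square prob_space)
qed

lemma poisson_moments: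
  assumes "prob_space N" and Z: "Z \<in> measurable N (count_space UNIV)"
    "distr N (count_space UNIV) Z = measure_pmf (poisson_pmf lam)" and lam: "lam > 0"
  shows "(\<integral>x. real (Z x) \<partial>N) = lam" and "2 * (\<integral>x. real (Z x choose 2) \<partial>N) = lam\<^sup>2"
proof -
  interpret prob_space N by fact
  note int = integrable_binomial[OF assms(1,2) size_bias_le_poisson[OF Z lam]]
  have int1: "integrable N (\<lambda>x. real (Z x))" using int[of 1] by simp
  show mean: "(\<integral>x. real (Z x) \<partial>N) = lam"
    using integral_poisson_mult[OF Z lam, of "\<lambda>_. 1"] int1 by (simp add: prob_space)
  have "integrable N (\<lambda>x. real (Z x) * real (Z x))"
    unfolding square_eq_binomial using int[of 2] int1 by simp
  then have "(\<integral>x. real (Z x) * real (Z x) \<partial>N) = lam * (1 + lam)"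
    using integral_poisson_mult[OF Z lam, of real] int1 mean by (simp add: prob_space)
  then show "2 * (\<integral>x. real (Z x choose 2) \<partial>N) = lam\<^sup>2"
    unfolding square_eq_binomial using int[of 2] int1 mean by (simp add: algebra_simps power2_eq_square)
qed

theorem theorem2p1:
  fixes M :: "'a measure" and W :: "'a \<Rightarrow> nat"
    and N :: "'b measure" and Z :: "'b \<Rightarrow> nat"
    and L :: "'c measure" and Wstar :: "'c \<Rightarrow> nat"
    and lam :: real and s :: nat
  assumes "prob_space M" and "W \<in> measurable M (count_space UNIV)"
    and "integrable M (\<lambda>x. real (W x))" and "(\<integral>x. real (W x) \<partial>M) = lam" and "lam > 0"
    and "prob_space N" and "Z \<in> measurable N (count_space UNIV)"
    and "distr N (count_space UNIV) Z = measure_pmf (poisson_pmf lam)"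
    and "s \<ge> 1"
    and "\<And>k. k \<in> {3..s} \<Longrightarrow>
           ext_expectation M (\<lambda>x. real (W x choose k)) \<le> ext_expectation N (\<lambda>y. real (Z y choose k))"
    and "prob_space L" and "Wstar \<in> measurable L (count_space UNIV)"
    and "has_size_biased_distribution M W L Wstar"
    and "s_convex_le s L Wstar M (\<lambda>x. W x + 1)"
  shows "s_convex_le (s + 1) M W N Z"
proof -
  note [measurable] = assms(2,7,12)
  have sbM: "size_bias_le lam s M W"
    unfolding size_bias_le_def
  proof (intro ballI impI)
    fix g assume g: "g \<in> cx_functions s" and nonneg: "\<forall>j. 0 \<le> g j"
    have "ext_expectation L (\<lambda>y. g (Wstar y)) \<le> ext_expectation M (\<lambda>x. g (W x + 1))"
      using assms(14) g unfolding s_convex_le_def by blast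
    then have "(\<integral>\<^sup>+ y. ennreal (g (Wstar y)) \<partial>L) \<le> (\<integral>\<^sup>+ x. ennreal (g (Suc (W x))) \<partial>M)"
      using nonneg by (simp add: ext_expectation_nonneg less_eq_ennreal.rep_eq[symmetric])
    then show "(\<integral>\<^sup>+ x. ennreal (real (W x) * g (W x)) \<partial>M) \<le> ennreal lam * (\<integral>\<^sup>+ x. ennreal (g (Suc (W x))) \<partial>M)"
      using nn_integral_size_biased[OF assms(1,2,11-13,4,5), of g] nonneg
      by (simp add: mult_left_mono)
  qed
  note M = assms(1,2) sbM
  note N = assms(6,7) size_bias_le_poisson[OF assms(7,8,5), of s]
  have nn_binom: "(\<integral>\<^sup>+ x. ennreal (real (W x choose k)) \<partial>M) \<le> (\<integral>\<^sup>+ x. ennreal (real (Z x choose k)) \<partial>N)"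
    if k: "k \<in> {1..s}" for k
  proof (cases "k \<ge> 3")
    case True
    then show ?thesis using assms(10)[of k] k
      by (simp add: ext_expectation_nonneg less_eq_ennreal.rep_eq[symmetric])
  next
    case False
    then have "k = 1 \<or> k = 2" using k by auto
    then have "(\<integral>x. real (W x choose k) \<partial>M) \<le> (\<integral>x. real (Z x choose k) \<partial>N)"
      using second_moment_le[OF M assms(4,5)] poisson_moments[OF assms(6,7,8,5)] assms(4) by auto
    then show ?thesis
      by (simp add: nn_integral_eq_integral integrable_binomial[OF M] integrable_binomial[OF N] ennreal_leI)
  qed
  obtain r where r: "s = Suc r" using assms(9) by (cases s) auto
  have "ennreal (\<integral>x. real (W x choose s) \<partial>M) \<le> ennreal (\<integral>x. real (Z x choose s) \<partial>N)"
    using nn_binom[of s] assms(9)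
    by (simp add: nn_integral_eq_integral integrable_binomial[OF M] integrable_binomial[OF N])
  then have "(\<integral>x. real (W x choose s) \<partial>M) \<le> (\<integral>x. real (Z x choose s) \<partial>N)"
    by (simp add: integral_nonneg)
  then have trunc: "(\<integral>x. truncated_binomial t s (W x) \<partial>M) \<le> (\<integral>x. truncated_binomial t s (Z x) \<partial>N)" for t
    using truncated_moment_le[OF assms(1,2) sbM[unfolded r] assms(6,7,8,5)] unfolding r by blast
  have nn_trunc: "(\<integral>\<^sup>+ x. ennreal (truncated_binomial t s (W x)) \<partial>M) \<le> (\<integral>\<^sup>+ x. ennreal (truncated_binomial t s (Z x)) \<partial>N)" for t
    using trunc[of t]
    by (simp add: nn_integral_eq_integral integrable_truncated_binomial[OF M] integrable_truncated_binomial[OF N] ennreal_leI)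
  show ?thesis
    unfolding s_convex_le_def
  proof
    fix f assume "f \<in> cx_functions (s + 1)"
    then have f: "f \<in> cx_functions (Suc s)" by simp
    have "(\<integral>\<^sup>+ x. ennreal (f (W x) - f 0) \<partial>M) \<le> (\<integral>\<^sup>+ x. ennreal (f (Z x) - f 0) \<partial>N)"
      unfolding nn_integral_newton_expansion[OF f assms(2)] nn_integral_newton_expansion[OF f assms(7)]
      by (intro add_mono sum_mono suminf_le mult_left_mono nn_binom nn_trunc summableI) auto
    moreover have "ext_expectation M (\<lambda>x. f (W x)) = enn2ereal (\<integral>\<^sup>+ x. ennreal (f (W x) - f 0) \<partial>M) + ereal (f 0)"
      by (rule ext_expectation_bounded_below[OF assms(1)]) (auto intro: cx_functions_ge_0[OF f])
    moreover have "ext_expectation N (\<lambda>x. f (Z x)) = enn2ereal (\<integral>\<^sup>+ x. ennreal (f (Z x) - f 0) \<partial>N) + ereal (f 0)"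
      by (rule ext_expectation_bounded_below[OF assms(6)]) (auto intro: cx_functions_ge_0[OF f])
    ultimately show "ext_expectation M (\<lambda>x. f (W x)) \<le> ext_expectation N (\<lambda>y. f (Z y))"
      by (simp add: less_eq_ennreal.rep_eq add_right_mono)
  qed
qed

end
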